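(* Let $\xi_0,\ldots,\xi_r \in \mathbb{R}$ with $r\ge 1$, write $\underline{\xi} = (\xi_0,\ldots,\xi_r)$, and assume that $s = \dim_{\mathbb{Q}} \mathrm{Span}_{\mathbb{Q}}(\xi_0,\ldots,\xi_r) - 1$ is positive. Then $$\tau_r'''(\underline{\xi}) \le \tau_r''(\underline{\xi}) \le \tau_r'(\underline{\xi}) \le \tau_r(\underline{\xi}) \le \frac{1}{\omega_0(\underline{\xi})} \le s.$$
   Context: A linear form is $L = \ell_0X_0 + \cdots + \ell_rX_r$ with $\ell_i\in\mathbb{Z}$; set $H(L) = \max_i |\ell_i|$ and $L(\underline{\xi}) = \ell_0\xi_0+\cdots+\ell_r\xi_r$. Below, "$x_n = y_n^{a+o(1)}$" (resp. "$\le$") means $x_n = y_n^{a+\delta_n}$ (resp. $x_n\le y_n^{a+\delta_n}$) for some real sequence $\delta_n\to 0$ as $n\to\infty$. Define: (1) $\mathcal{T}_r(\underline{\xi})$: the set of $\tau>0$ for which there exists a sequence $(L_n)$ of linear forms with $L_n(\underline{\xi})\ne 0$ for all $n$, $L_n(\underline{\xi})\to 0$, $|L_{n+1}(\underline{\xi})| = |L_n(\underline{\xi})|^{1+o(1)}$, and $|L_n(\underline{\xi})| \le H(L_n)^{-\tau+o(1)}$. (2) $\mathcal{T}_r'(\underline{\xi})$: the set of $\tau>0$ for which there exist a sequence $(L_n)$ of linear forms and reals $0<\alpha<1<\beta$ with $|L_n(\underline{\xi})|^{1/n}\to\alpha$, $\limsup_n H(L_n)^{1/n}\le\beta$, and $\tau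 = -\log\alpha/\log\beta$. (3) $\mathcal{T}_r''(\underline{\xi})$: the set of $\tau>0$ such that for every increasing sequence $(Q_n)$ of positive integers there is a sequence $(L_n)$ of linear forms with $H(L_n)\le Q_n^{1+o(1)}$ and $|L_n(\underline{\xi})| = Q_n^{-\tau+o(1)}$. (4) $\mathcal{T}_r'''(\underline{\xi})$: the set of $\tau>0$ such that for all sequences $(Q_n),(\varepsilon_n)$ of positive reals with $Q_n\to+\infty$, $\varepsilon_n\to 0$ and $\varepsilon_n\ge Q_n^{-\tau+o(1)}$, there is a sequence $(L_n)$ of linear forms with $\lim_n H(L_n)/Q_n = \lim_n L_n(\underline{\xi})/\varepsilon_n = 1$. Set $\tau_r(\underline{\xi}) = \sup\mathcal{T}_r(\underline{\xi})$, and similarly $\tau_r', \tau_r'', \tau_r'''$, with $\sup\emptyset = 0$. Let $\omega_0(\underline{\xi})$ be the supremum (possibly $+\infty$) of the set of $\omega>0$ such that there are infinitely many $(q_0,\ldots,q_r)\in\mathbb{Z}^{r+1}$ with $|q_i\xi_j - q_j\xi_i| \le \max(|q_0|,\ldots,|q_r|)^{-\omega}$ for all $0\le i<j\le r$; here $1/(+\infty) = 0$. *)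

theory Defs
  imports Complex_Main "HOL-Library.Extended_Real" "HOL-Library.FuncSet"
begin

text \<open>A point is a function \<open>nat \<Rightarrow> real\<close> and a linear form is its coefficient function
  \<open>nat \<Rightarrow> int\<close>; in both cases only the values at \<open>0, \<dots>, r\<close> are ever used.\<close>

definition form_eval :: "nat \<Rightarrow> (nat \<Rightarrow> int) \<Rightarrow> (nat \<Rightarrow> real) \<Rightarrow> real" where
  "form_eval r L \<xi> = (\<Sum>i\<le>r. of_int (L i) * \<xi> i)"

definition form_height :: "nat \<Rightarrow> (nat \<Rightarrow> int) \<Rightarrow> int" where
  "form_height r L = (MAX i\<in>{..r}. \<bar>L i\<bar>)"

text \<open>The relations \<open>x\<^sub>n = y\<^sub>n\<^bsup>a+o(1)\<^esup>\<close> and \<open>x\<^sub>n \<le> y\<^sub>n\<^bsup>a+o(1)\<^esup>\<close> are asymptotic, so they are only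
  required for all large \<open>n\<close>. This matters where \<open>y\<^sub>n = 1\<close>: the power is then \<open>1\<close> whatever
  the exponent is, and in \<open>T_set''\<close> below an initial term \<open>Q\<^sub>0 = 1\<close> would otherwise
  force \<open>\<bar>L\<^sub>0(\<xi>)\<bar> = 1\<close>.\<close>

definition eq_pow_o1 :: "(nat \<Rightarrow> real) \<Rightarrow> (nat \<Rightarrow> real) \<Rightarrow> real \<Rightarrow> bool" where
  "eq_pow_o1 x y a \<longleftrightarrow>
     (\<exists>\<delta>. \<delta> \<longlonglongrightarrow> 0 \<and> (\<forall>\<^sub>F n in sequentially. x n = y n powr (a + \<delta> n)))"

definition le_pow_o1 :: "(nat \<Rightarrow> real) \<Rightarrow> (nat \<Rightarrow> real) \<Rightarrow> real \<Rightarrow> bool" where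
  "le_pow_o1 x y a \<longleftrightarrow>
     (\<exists>\<delta>. \<delta> \<longlonglongrightarrow> 0 \<and> (\<forall>\<^sub>F n in sequentially. x n \<le> y n powr (a + \<delta> n)))"

definition ge_pow_o1 :: "(nat \<Rightarrow> real) \<Rightarrow> (nat \<Rightarrow> real) \<Rightarrow> real \<Rightarrow> bool" where
  "ge_pow_o1 x y a \<longleftrightarrow>
     (\<exists>\<delta>. \<delta> \<longlonglongrightarrow> 0 \<and> (\<forall>\<^sub>F n in sequentially. x n \<ge> y n powr (a + \<delta> n)))"

definition T_set :: "nat \<Rightarrow> (nat \<Rightarrow> real) \<Rightarrow> real set" where
  "T_set r \<xi> = {\<tau>. \<tau> > 0 \<and> (\<exists>L :: nat \<Rightarrow> nat \<Rightarrow> int.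
     (\<forall>n. form_eval r (L n) \<xi> \<noteq> 0) \<and>
     (\<lambda>n. form_eval r (L n) \<xi>) \<longlonglongrightarrow> 0 \<and>
     eq_pow_o1 (\<lambda>n. \<bar>form_eval r (L (Suc n)) \<xi>\<bar>) (\<lambda>n. \<bar>form_eval r (L n) \<xi>\<bar>) 1 \<and>
     le_pow_o1 (\<lambda>n. \<bar>form_eval r (L n) \<xi>\<bar>) (\<lambda>n. of_int (form_height r (L n))) (- \<tau>))}"

definition T_set' :: "nat \<Rightarrow> (nat \<Rightarrow> real) \<Rightarrow> real set" where
  "T_set' r \<xi> = {\<tau>. \<tau> > 0 \<and> (\<exists>(L :: nat \<Rightarrow> nat \<Rightarrow> int) \<alpha> \<beta>.
     0 < \<alpha> \<and> \<alpha> < 1 \<and> 1 < \<beta> \<and>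
     (\<lambda>n. root n \<bar>form_eval r (L n) \<xi>\<bar>) \<longlonglongrightarrow> \<alpha> \<and>
     limsup (\<lambda>n. ereal (root n (of_int (form_height r (L n))))) \<le> ereal \<beta> \<and>
     \<tau> = - ln \<alpha> / ln \<beta>)}"

definition T_set'' :: "nat \<Rightarrow> (nat \<Rightarrow> real) \<Rightarrow> real set" where
  "T_set'' r \<xi> = {\<tau>. \<tau> > 0 \<and> (\<forall>Q :: nat \<Rightarrow> nat. strict_mono Q \<longrightarrow> (\<forall>n. Q n > 0) \<longrightarrow>
     (\<exists>L :: nat \<Rightarrow> nat \<Rightarrow> int.
       le_pow_o1 (\<lambda>n. of_int (form_height r (L n))) (\<lambda>n. of_nat (Q n)) 1 \<and>
       eq_pow_o1 (\<lambda>n. \<bar>form_eval r (L n) \<xi>\<bar>) (\<lambda>n. of_nat (Q n)) (- \<tau>)))}"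

definition T_set''' :: "nat \<Rightarrow> (nat \<Rightarrow> real) \<Rightarrow> real set" where
  "T_set''' r \<xi> = {\<tau>. \<tau> > 0 \<and> (\<forall>(Q :: nat \<Rightarrow> real) (\<epsilon> :: nat \<Rightarrow> real).
     (\<forall>n. Q n > 0) \<longrightarrow> (\<forall>n. \<epsilon> n > 0) \<longrightarrow>
     filterlim Q at_top sequentially \<longrightarrow> \<epsilon> \<longlonglongrightarrow> 0 \<longrightarrow> ge_pow_o1 \<epsilon> Q (- \<tau>) \<longrightarrow>
     (\<exists>L :: nat \<Rightarrow> nat \<Rightarrow> int.
       (\<lambda>n. of_int (form_height r (L n)) / Q n) \<longlonglongrightarrow> 1 \<and>
       (\<lambda>n. form_eval r (L n) \<xi> / \<epsilon> n) \<longlonglongrightarrow> 1))}"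

definition sup0 :: "real set \<Rightarrow> ereal" where
  "sup0 A = (if A = {} then 0 else Sup (ereal ` A))"

definition tau :: "nat \<Rightarrow> (nat \<Rightarrow> real) \<Rightarrow> ereal" where
  "tau r \<xi> = sup0 (T_set r \<xi>)"

definition tau' :: "nat \<Rightarrow> (nat \<Rightarrow> real) \<Rightarrow> ereal" where
  "tau' r \<xi> = sup0 (T_set' r \<xi>)"

definition tau'' :: "nat \<Rightarrow> (nat \<Rightarrow> real) \<Rightarrow> ereal" where
  "tau'' r \<xi> = sup0 (T_set'' r \<xi>)"

definition tau''' :: "nat \<Rightarrow> (nat \<Rightarrow> real) \<Rightarrow> ereal" where
  "tau''' r \<xi> = sup0 (T_set''' r \<xi>)"

text \<open>Integer tuples are taken extensional, so that distinct functions are distinct tuples.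
  The set of exponents is never empty (Dirichlet).\<close>

definition omega0 :: "nat \<Rightarrow> (nat \<Rightarrow> real) \<Rightarrow> ereal" where
  "omega0 r \<xi> = Sup (ereal ` {\<omega>. \<omega> > 0 \<and>
     infinite {q \<in> {..r} \<rightarrow>\<^sub>E (UNIV :: int set).
       \<forall>i j. i < j \<and> j \<le> r \<longrightarrow>
         \<bar>of_int (q i) * \<xi> j - of_int (q j) * \<xi> i\<bar>
           \<le> of_int (MAX k\<in>{..r}. \<bar>q k\<bar>) powr (- \<omega>)}})"

definition rat_scale :: "rat \<Rightarrow> real \<Rightarrow> real" where
  "rat_scale c x = of_rat c * x"

lemma vector_space_rat_scale: "vector_space rat_scale"
  by unfold_locales (simp_all add: rat_scale_def algebra_simps of_rat_add of_rat_mult)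

definition rat_span :: "real set \<Rightarrow> real set" where
  "rat_span = module.span rat_scale"

definition rat_dim :: "real set \<Rightarrow> nat" where
  "rat_dim = vector_space.dim rat_scale"

end

theory Submission
  imports Defs "HOL-Analysis.Kronecker_Approximation_Theorem"
begin

text \<open>The four sets are nested: take \<open>\<epsilon>\<^sub>n = Q\<^sub>n\<^bsup>-\<tau>\<^esup>\<close> for \<open>T_set''' \<subseteq> T_set''\<close> and \<open>Q\<^sub>n = 2\<^sup>n\<close> for
  \<open>T_set'' \<subseteq> T_set'\<close>, and drop the initial terms for \<open>T_set' \<subseteq> T_set\<close>.

  Let \<open>\<tau>\<close> be in \<open>T_set\<close>, and let \<open>q\<close> have large height \<open>Q\<close> and exponent \<open>\<omega>\<close>. For the first \<open>n\<close> with
  \<open>\<bar>L\<^sub>n(\<xi>)\<bar> < c / Q\<close> one has \<open>\<bar>L\<^sub>n(\<xi>)\<bar> = Q\<^bsup>-1+o(1)\<^esup>\<close>, hence \<open>H(L\<^sub>n) \<le> Q\<^bsup>1/\<tau>+o(1)\<^esup>\<close>. Comparing \<open>L\<^sub>n(q) \<xi>\<^sub>k\<close> with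
  \<open>q\<^sub>k L\<^sub>n(\<xi>)\<close>, whose difference is at most \<open>(r + 1) H(L\<^sub>n) Q\<^bsup>-\<omega>\<^esup>\<close>, gives \<open>Q\<^bsup>-o(1)\<^esup> \<le> Q\<^bsup>1/\<tau>-\<omega>+o(1)\<^esup>\<close>, that is,
  \<open>\<tau> \<omega> \<le> 1\<close>. Finally, Dirichlet's simultaneous approximation theorem for a basis of the span
  shows that every \<open>\<omega> < 1 / s\<close> is attained.\<close>

section \<open>Powers with an exponent known up to o(1)\<close>

lemma le_pow_o1D:
  assumes "le_pow_o1 x y a" "\<forall>\<^sub>F n in sequentially. 1 \<le> y n" "\<epsilon> > 0"
  shows "\<forall>\<^sub>F n in sequentially. x n \<le> y n powr (a + \<epsilon>)"
proof -
  obtain \<delta> where \<delta>: "\<delta> \<longlonglongrightarrow> 0" "\<forall>\<^sub>F n in sequentially. x n \<le> y n powr (a + \<delta> n)"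
    using assms(1) unfolding le_pow_o1_def by blast
  have "\<forall>\<^sub>F n in sequentially. \<delta> n < \<epsilon>"
    using \<delta>(1) assms(3) by (rule order_tendstoD)
  with \<delta>(2) assms(2) show ?thesis
  proof eventually_elim
    case (elim n)
    have "y n powr (a + \<delta> n) \<le> y n powr (a + \<epsilon>)"
      using elim by (intro powr_mono) auto
    with elim show ?case by linarith
  qed
qed

text \<open>One error sequence has to serve every \<open>\<epsilon>\<close> at once. The least
  nonnegative correction of the exponent does this: it is 0 where \<open>x n\<close> is already
  below \<open>y n powr a\<close>, and otherwise the exact logarithmic exponent minus
  \<open>a\<close>. The bound for each fixed \<open>\<epsilon>\<close> then squeezes it to
  0.\<close>

lemma le_pow_o1I:
  assumes le: "\<And>\<epsilon>. \<epsilon> > 0 \<Longrightarrow> \<forall>\<^sub>F n in sequentially. x n \<le> y n powr (a + \<epsilon>)"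
    and y: "\<forall>\<^sub>F n in sequentially. 1 \<le> y n"
  shows "le_pow_o1 x y a"
proof -
  define \<delta> where "\<delta> n = (if x n \<le> y n powr a then 0 else ln (x n) / ln (y n) - a)" for n
  have bounds: "\<forall>\<^sub>F n in sequentially. 0 \<le> \<delta> n \<and> \<delta> n \<le> \<epsilon> \<and> x n \<le> y n powr (a + \<delta> n)"
    if \<epsilon>: "\<epsilon> > 0" for \<epsilon>
    using le[OF \<epsilon>] y
  proof eventually_elim
    case (elim n)
    show ?case
    proof (cases "x n \<le> y n powr a")
      case True
      then show ?thesis using \<epsilon> by (simp add: \<delta>_def)
    next
      case False
      \<comment> \<open>At \<open>y n = 1\<close> every power equals 1, so the bound with
        \<open>a + \<epsilon>\<close> would already be the one with \<open>a\<close>, against the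
        case assumption. Hence \<open>ln (y n)\<close> is positive and may be divided by.\<close>
      have y1: "y n > 1"
        using elim False by (cases "y n = 1") auto
      have pos: "x n > 0"
        using False powr_ge_zero[of "y n" a] by linarith
      have "a * ln (y n) \<le> ln (x n)"
        using False y1 pos by (metis ln_mono ln_powr less_eq_real_def linorder_not_le powr_gt_zero not_one_less_zero)
      moreover have "ln (x n) \<le> (a + \<epsilon>) * ln (y n)"
        using elim(1) pos y1 by (metis ln_mono ln_powr not_one_less_zero)
      moreover have "y n powr (ln (x n) / ln (y n)) = x n"
        using y1 pos by (simp add: powr_def)
      ultimately show ?thesis
        using y1 False by (simp add: \<delta>_def field_simps)
    qed
  qed
  have "\<delta> \<longlonglongrightarrow> 0"
  proof (rule LIMSEQ_I)
    fix \<epsilon> :: real assume "\<epsilon> > 0"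
    then have "\<forall>\<^sub>F n in sequentially. norm (\<delta> n - 0) < \<epsilon>"
      using bounds[of "\<epsilon> / 2"] by (auto elim: eventually_mono)
    then show "\<exists>N. \<forall>n\<ge>N. norm (\<delta> n - 0) < \<epsilon>"
      by (simp add: eventually_sequentially)
  qed
  moreover have "\<forall>\<^sub>F n in sequentially. x n \<le> y n powr (a + \<delta> n)"
    using bounds[of 1] by (auto elim: eventually_mono)
  ultimately show ?thesis
    unfolding le_pow_o1_def by blast
qed

text \<open>Taking logarithms turns the unknown exponent into a quotient with a limit. The value 1
  of \<open>y n\<close> is excluded because its logarithm is 0 and such a quotient carries no
  information.\<close>

lemma eq_pow_o1D:
  assumes "eq_pow_o1 x y a" "\<forall>\<^sub>F n in sequentially. y n > 0 \<and> y n \<noteq> 1"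
  shows "(\<lambda>n. ln (x n) / ln (y n)) \<longlonglongrightarrow> a"
proof -
  obtain \<delta> where \<delta>: "\<delta> \<longlonglongrightarrow> 0" "\<forall>\<^sub>F n in sequentially. x n = y n powr (a + \<delta> n)"
    using assms(1) unfolding eq_pow_o1_def by blast
  have "(\<lambda>n. a + \<delta> n) \<longlonglongrightarrow> a"
    using tendsto_add[OF tendsto_const \<delta>(1), of a] by simp
  moreover have "\<forall>\<^sub>F n in sequentially. a + \<delta> n = ln (x n) / ln (y n)"
    using \<delta>(2) assms(2) by eventually_elim (simp add: ln_powr)
  ultimately show ?thesis
    by (rule Lim_transform_eventually)
qed

lemma eq_pow_o1I:
  assumes "(\<lambda>n. ln (x n) / ln (y n)) \<longlonglongrightarrow> a"
    and "\<forall>\<^sub>F n in sequentially. y n > 0 \<and> y n \<noteq> 1" "\<forall>\<^sub>F n in sequentially. x n > 0"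
  shows "eq_pow_o1 x y a"
  unfolding eq_pow_o1_def
proof (intro exI conjI)
  show "(\<lambda>n. ln (x n) / ln (y n) - a) \<longlonglongrightarrow> 0"
    using assms(1) by (rule LIM_zero)
  show "\<forall>\<^sub>F n in sequentially. x n = y n powr (a + (ln (x n) / ln (y n) - a))"
    using assms(2,3) by eventually_elim (simp add: powr_def)
qed

section \<open>Linear forms\<close>

lemma abs_le_form_height: "i \<le> r \<Longrightarrow> \<bar>L i\<bar> \<le> form_height r L"
  unfolding form_height_def by (intro Max_ge) auto

lemma form_height_nonneg: "0 \<le> form_height r L"
  using abs_le_form_height[of 0 r L] by linarith

lemma form_height_attained: "\<exists>i\<le>r. \<bar>L i\<bar> = form_height r L"
proof -
  have "form_height r L \<in> (\<lambda>i. \<bar>L i\<bar>) ` {..r}"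
    unfolding form_height_def by (intro Max_in) auto
  then show ?thesis by auto
qed

lemma form_height_ge_1: "i \<le> r \<Longrightarrow> L i \<noteq> 0 \<Longrightarrow> 1 \<le> form_height r L"
  using abs_le_form_height[of i r L] by linarith

lemma form_height_ge_1_if_eval:
  assumes "form_eval r L \<xi> \<noteq> 0"
  shows "1 \<le> form_height r L"
proof -
  have "\<exists>i\<le>r. L i \<noteq> 0"
    using assms unfolding form_eval_def by (auto intro: ccontr)
  then show ?thesis using form_height_ge_1 by blast
qed

lemma abs_form_eval_le:
  assumes "\<And>i. i \<le> r \<Longrightarrow> \<bar>\<xi> i\<bar> \<le> B"
  shows "\<bar>form_eval r L \<xi>\<bar> \<le> real (Suc r) * of_int (form_height r L) * B"
proof -
  have "\<bar>form_eval r L \<xi>\<bar> \<le> (\<Sum>i\<le>r. \<bar>of_int (L i) * \<xi> i\<bar>)"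
    unfolding form_eval_def by (rule sum_abs)
  also have "\<dots> \<le> (\<Sum>i\<le>r. of_int (form_height r L) * B)"
  proof (intro sum_mono)
    fix i assume i: "i \<in> {..r}"
    have "real_of_int \<bar>L i\<bar> \<le> of_int (form_height r L)"
      using i by (simp only: of_int_le_iff abs_le_form_height atMost_iff)
    then show "\<bar>of_int (L i) * \<xi> i\<bar> \<le> of_int (form_height r L) * B"
      using i assms by (simp add: abs_mult mult_mono form_height_nonneg)
  qed
  finally show ?thesis by simp
qed

text \<open>This is what lets an infinite set of integer tuples supply one of arbitrarily large
  height.\<close>

lemma finite_bounded_height: "finite {q \<in> {..r} \<rightarrow>\<^sub>E UNIV. form_height r q \<le> B}"
proof (rule finite_subset)
  show "{q \<in> {..r} \<rightarrow>\<^sub>E UNIV. form_height r q \<le> B} \<subseteq> {..r} \<rightarrow>\<^sub>E {- B..B}"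
  proof
    fix q assume q: "q \<in> {q \<in> {..r} \<rightarrow>\<^sub>E UNIV. form_height r q \<le> B}"
    have "- B \<le> q i \<and> q i \<le> B" if "i \<le> r" for i
      using abs_le_form_height[of i r q] that q by simp linarith
    moreover have "q i = undefined" if "i \<notin> {..r}" for i
      using q that by (simp add: PiE_iff extensional_def)
    ultimately show "q \<in> {..r} \<rightarrow>\<^sub>E {- B..B}"
      by (intro PiE_I) simp_all
  qed
  show "finite ({..r} \<rightarrow>\<^sub>E {- B..B})"
    by (intro finite_PiE) auto
qed

section \<open>The inclusions between the exponent sets\<close>

lemma T_set'''_subset_T_set'': "T_set''' r \<xi> \<subseteq> T_set'' r \<xi>"
proof
  fix \<tau> assume \<tau>: "\<tau> \<in> T_set''' r \<xi>"
  then have pos: "\<tau> > 0" by (simp add: T_set'''_def)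
  have "\<exists>L. le_pow_o1 (\<lambda>n. of_int (form_height r (L n))) (\<lambda>n. real (Q n)) 1 \<and>
      eq_pow_o1 (\<lambda>n. \<bar>form_eval r (L n) \<xi>\<bar>) (\<lambda>n. real (Q n)) (- \<tau>)"
    if Q: "strict_mono Q" "\<And>n. Q n > 0" for Q :: "nat \<Rightarrow> nat"
  proof -
    have Qlim: "filterlim (\<lambda>n. real (Q n)) at_top sequentially"
      using filterlim_compose[OF filterlim_real_sequentially filterlim_subseq[OF Q(1)]] .
    have Qgt1: "\<forall>\<^sub>F n in sequentially. real (Q n) > 1"
      using filterlim_at_top_dense[THEN iffD1, rule_format, OF Qlim] .
    define \<epsilon> where "\<epsilon> n = real (Q n) powr (- \<tau>)" for n
    have \<epsilon>lim: "\<epsilon> \<longlonglongrightarrow> 0"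
      unfolding \<epsilon>_def by (rule tendsto_neg_powr[OF _ Qlim]) (use pos in simp)
    have "ge_pow_o1 \<epsilon> (\<lambda>n. real (Q n)) (- \<tau>)"
      unfolding ge_pow_o1_def \<epsilon>_def by (rule exI[of _ "\<lambda>_. 0"]) simp
    moreover have "\<forall>n. 0 < real (Q n)" "\<forall>n. 0 < \<epsilon> n"
      using Q(2) by (simp_all add: \<epsilon>_def)
    ultimately have "\<exists>L. (\<lambda>n. of_int (form_height r (L n)) / real (Q n)) \<longlonglongrightarrow> 1 \<and>
        (\<lambda>n. form_eval r (L n) \<xi> / \<epsilon> n) \<longlonglongrightarrow> 1"
      using \<tau> Qlim \<epsilon>lim by (simp add: T_set'''_def)
    then obtain L where
      L: "(\<lambda>n. of_int (form_height r (L n)) / real (Q n)) \<longlonglongrightarrow> 1"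
        "(\<lambda>n. form_eval r (L n) \<xi> / \<epsilon> n) \<longlonglongrightarrow> 1"
      by blast
    have "le_pow_o1 (\<lambda>n. of_int (form_height r (L n))) (\<lambda>n. real (Q n)) 1"
    proof (rule le_pow_o1I)
      fix e :: real assume e: "e > 0"
      have "filterlim (\<lambda>n. real (Q n) powr e) at_top sequentially"
        using filterlim_compose[OF real_powr_at_top[OF e] Qlim] .
      then have "\<forall>\<^sub>F n in sequentially. real (Q n) powr e > 2"
        unfolding filterlim_at_top_dense by blast
      moreover have "\<forall>\<^sub>F n in sequentially. of_int (form_height r (L n)) / real (Q n) < 2"
        using L(1) by (rule order_tendstoD) simp
      ultimately show "\<forall>\<^sub>F n in sequentially. of_int (form_height r (L n)) \<le> real (Q n) powr (1 + e)"
      proof eventually_elim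
        case (elim n)
        have "of_int (form_height r (L n)) \<le> real (Q n) * 2"
          using elim(2) Q(2)[of n] by (simp add: field_simps)
        also have "\<dots> \<le> real (Q n) * real (Q n) powr e"
          using elim(1) by (intro mult_left_mono) auto
        finally show ?case
          using Q(2)[of n] by (simp add: powr_add)
      qed
    qed (use Qgt1 in \<open>auto elim: eventually_mono\<close>)
    moreover have "eq_pow_o1 (\<lambda>n. \<bar>form_eval r (L n) \<xi>\<bar>) (\<lambda>n. real (Q n)) (- \<tau>)"
    proof (rule eq_pow_o1I)
      have ev: "\<forall>\<^sub>F n in sequentially. form_eval r (L n) \<xi> / \<epsilon> n > 0"
        using L(2) by (rule order_tendstoD) simp
      \<comment> \<open>The logarithm of the quotient stays bounded while \<open>ln (Q n)\<close>
        grows, so replacing \<open>\<epsilon> n\<close> by the value of the form does not change the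
        limiting exponent \<open>- \<tau>\<close>.\<close>
      have "(\<lambda>n. ln (form_eval r (L n) \<xi> / \<epsilon> n)) \<longlonglongrightarrow> ln 1"
        using L(2) by (rule tendsto_ln) simp
      moreover have "filterlim (\<lambda>n. ln (real (Q n))) at_top sequentially"
        using filterlim_compose[OF ln_at_top Qlim] .
      ultimately have "(\<lambda>n. ln (form_eval r (L n) \<xi> / \<epsilon> n) / ln (real (Q n))) \<longlonglongrightarrow> 0"
        by (rule real_tendsto_divide_at_top)
      from tendsto_add[OF tendsto_const this, of "- \<tau>"]
      have "(\<lambda>n. - \<tau> + ln (form_eval r (L n) \<xi> / \<epsilon> n) / ln (real (Q n))) \<longlonglongrightarrow> - \<tau>"
        by simp
      moreover have "\<forall>\<^sub>F n in sequentially. - \<tau> + ln (form_eval r (L n) \<xi> / \<epsilon> n) / ln (real (Q n))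
          = ln \<bar>form_eval r (L n) \<xi>\<bar> / ln (real (Q n))"
        using ev Qgt1
      proof eventually_elim
        case (elim n)
        have e: "\<epsilon> n > 0" "ln (\<epsilon> n) = - \<tau> * ln (real (Q n))"
          using elim(2) by (auto simp: \<epsilon>_def ln_powr)
        have "form_eval r (L n) \<xi> > 0"
          using elim(1) e(1) by (simp add: zero_less_divide_iff)
        then show ?case
          using e elim(2) by (simp add: ln_div field_simps)
      qed
      ultimately show "(\<lambda>n. ln \<bar>form_eval r (L n) \<xi>\<bar> / ln (real (Q n))) \<longlonglongrightarrow> - \<tau>"
        by (rule Lim_transform_eventually)
      show "\<forall>\<^sub>F n in sequentially. \<bar>form_eval r (L n) \<xi>\<bar> > 0"
        using ev by eventually_elim auto
    qed (use Qgt1 in \<open>auto elim: eventually_mono\<close>)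
    ultimately show ?thesis by blast
  qed
  with pos show "\<tau> \<in> T_set'' r \<xi>" by (simp add: T_set''_def)
qed

lemma T_set''_subset_T_set': "T_set'' r \<xi> \<subseteq> T_set' r \<xi>"
proof
  fix \<tau> assume \<tau>: "\<tau> \<in> T_set'' r \<xi>"
  then have pos: "\<tau> > 0" by (simp add: T_set''_def)
  have "strict_mono (\<lambda>n. 2 ^ n :: nat)" "\<forall>n. (2 ^ n :: nat) > 0"
    by (auto simp: strict_mono_def)
  then obtain L where L: "le_pow_o1 (\<lambda>n. of_int (form_height r (L n))) (\<lambda>n. real (2 ^ n)) 1"
      "eq_pow_o1 (\<lambda>n. \<bar>form_eval r (L n) \<xi>\<bar>) (\<lambda>n. real (2 ^ n)) (- \<tau>)"
    using \<tau> unfolding T_set''_def by blast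
  obtain \<delta> where \<delta>: "\<delta> \<longlonglongrightarrow> 0"
      "\<forall>\<^sub>F n in sequentially. of_int (form_height r (L n)) \<le> real (2 ^ n) powr (1 + \<delta> n)"
    using L(1) unfolding le_pow_o1_def by blast
  obtain \<eta> where \<eta>: "\<eta> \<longlonglongrightarrow> 0"
      "\<forall>\<^sub>F n in sequentially. \<bar>form_eval r (L n) \<xi>\<bar> = real (2 ^ n) powr (- \<tau> + \<eta> n)"
    using L(2) unfolding eq_pow_o1_def by blast
  \<comment> \<open>With \<open>Q n = 2 ^ n\<close> the \<open>n\<close>-th roots remove the
    dependence on \<open>n\<close> except in the errors, which leads to \<alpha> =
    \<open>2 powr (- \<tau>)\<close> and \<beta> = 2. The index 0 is left out because
    \<open>root 0\<close> is constantly 0.\<close>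
  have root: "root n (real (2 ^ n) powr a) = 2 powr a" if "n > 0" for n a
  proof -
    have "real (2 ^ n) powr a = (2 powr a) ^ n"
      by (simp add: powr_powr powr_realpow[symmetric] mult.commute)
    then show ?thesis using that by (simp add: real_root_power_cancel)
  qed
  have "(\<lambda>n. 2 powr (- \<tau> + \<eta> n)) \<longlonglongrightarrow> 2 powr (- \<tau> + 0)"
    by (intro tendsto_intros \<eta>(1)) auto
  then have "(\<lambda>n. 2 powr (- \<tau> + \<eta> n)) \<longlonglongrightarrow> 2 powr (- \<tau>)"
    by simp
  moreover have "\<forall>\<^sub>F n in sequentially. 2 powr (- \<tau> + \<eta> n) = root n \<bar>form_eval r (L n) \<xi>\<bar>"
    using \<eta>(2) eventually_gt_at_top[of 0] by eventually_elim (simp only: root)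
  ultimately have "(\<lambda>n. root n \<bar>form_eval r (L n) \<xi>\<bar>) \<longlonglongrightarrow> 2 powr (- \<tau>)"
    by (rule Lim_transform_eventually)
  moreover have "limsup (\<lambda>n. ereal (root n (of_int (form_height r (L n))))) \<le> ereal 2"
  proof -
    have "(\<lambda>n. 2 powr (1 + \<delta> n)) \<longlonglongrightarrow> 2 powr (1 + 0)"
      by (intro tendsto_intros \<delta>(1)) auto
    then have "limsup (\<lambda>n. ereal (2 powr (1 + \<delta> n))) = ereal 2"
      by (intro lim_imp_Limsup tendsto_ereal) auto
    moreover have "\<forall>\<^sub>F n in sequentially.
        ereal (root n (of_int (form_height r (L n)))) \<le> ereal (2 powr (1 + \<delta> n))"
      using \<delta>(2) eventually_gt_at_top[of 0]
    proof eventually_elim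
      case (elim n)
      have "root n (of_int (form_height r (L n))) \<le> root n (real (2 ^ n) powr (1 + \<delta> n))"
        using elim by (intro real_root_le_mono)
      then show ?case using elim(2) by (simp only: root ereal_less_eq)
    qed
    ultimately show ?thesis using Limsup_mono by metis
  qed
  moreover have "0 < 2 powr (- \<tau>)" "2 powr (- \<tau>) < (1 :: real)" "1 < (2 :: real)" "\<tau> = - ln (2 powr (- \<tau>)) / ln 2"
    using pos by (auto simp: ln_powr powr_less_one)
  ultimately show "\<tau> \<in> T_set' r \<xi>"
    unfolding T_set'_def using pos by blast
qed

text \<open>\<open>T_set\<close> asks for nonvanishing at every index, whereas the other conditions
  are asymptotic and survive a shift. It is therefore enough to have nonvanishing eventually and to
  pass to a tail of the sequence.\<close>

lemma T_setI:
  assumes "\<tau> > 0" "\<forall>\<^sub>F n in sequentially. form_eval r (L n) \<xi> \<noteq> 0"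
    and "(\<lambda>n. form_eval r (L n) \<xi>) \<longlonglongrightarrow> 0"
    and eq: "eq_pow_o1 (\<lambda>n. \<bar>form_eval r (L (Suc n)) \<xi>\<bar>) (\<lambda>n. \<bar>form_eval r (L n) \<xi>\<bar>) 1"
    and le: "le_pow_o1 (\<lambda>n. \<bar>form_eval r (L n) \<xi>\<bar>) (\<lambda>n. of_int (form_height r (L n))) (- \<tau>)"
  shows "\<tau> \<in> T_set r \<xi>"
proof -
  obtain N where N: "\<And>n. n \<ge> N \<Longrightarrow> form_eval r (L n) \<xi> \<noteq> 0"
    using assms(2) unfolding eventually_sequentially by blast
  define M where "M n = L (n + N)" for n
  have "eq_pow_o1 (\<lambda>n. \<bar>form_eval r (M (Suc n)) \<xi>\<bar>) (\<lambda>n. \<bar>form_eval r (M n) \<xi>\<bar>) 1"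
  proof -
    obtain \<delta> where \<delta>: "\<delta> \<longlonglongrightarrow> 0" "\<forall>\<^sub>F n in sequentially.
        \<bar>form_eval r (L (Suc n)) \<xi>\<bar> = \<bar>form_eval r (L n) \<xi>\<bar> powr (1 + \<delta> n)"
      using eq unfolding eq_pow_o1_def by blast
    have "\<forall>\<^sub>F n in sequentially.
        \<bar>form_eval r (M (Suc n)) \<xi>\<bar> = \<bar>form_eval r (M n) \<xi>\<bar> powr (1 + \<delta> (n + N))"
      using sequentially_offset[OF \<delta>(2), of N] unfolding M_def by simp
    with LIMSEQ_ignore_initial_segment[OF \<delta>(1), of N] show ?thesis
      unfolding eq_pow_o1_def by blast
  qed
  moreover have "le_pow_o1 (\<lambda>n. \<bar>form_eval r (M n) \<xi>\<bar>) (\<lambda>n. of_int (form_height r (M n))) (- \<tau>)"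
  proof -
    obtain \<delta> where \<delta>: "\<delta> \<longlonglongrightarrow> 0" "\<forall>\<^sub>F n in sequentially.
        \<bar>form_eval r (L n) \<xi>\<bar> \<le> of_int (form_height r (L n)) powr (- \<tau> + \<delta> n)"
      using le unfolding le_pow_o1_def by blast
    have "\<forall>\<^sub>F n in sequentially.
        \<bar>form_eval r (M n) \<xi>\<bar> \<le> of_int (form_height r (M n)) powr (- \<tau> + \<delta> (n + N))"
      using sequentially_offset[OF \<delta>(2), of N] unfolding M_def by simp
    with LIMSEQ_ignore_initial_segment[OF \<delta>(1), of N] show ?thesis
      unfolding le_pow_o1_def by blast
  qed
  moreover have "\<forall>n. form_eval r (M n) \<xi> \<noteq> 0"
    by (simp add: M_def N)
  moreover have "(\<lambda>n. form_eval r (M n) \<xi>) \<longlonglongrightarrow> 0"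
    unfolding M_def using assms(3) by (rule LIMSEQ_ignore_initial_segment)
  ultimately show ?thesis
    unfolding T_set_def using assms(1) by blast
qed

lemma root_less_imp_less_power: "n > 0 \<Longrightarrow> 0 \<le> x \<Longrightarrow> root n x < a \<Longrightarrow> x < a ^ n"
  by (metis power_strict_mono real_root_ge_zero real_root_pow_pos2)

text \<open>The values are \<alpha>^(n + o(n)), the heights at most \<beta>^(n + o(n)), and \<alpha>
  = \<beta>^(-\<tau>). Consecutive values are comparable because (n + 1) / n tends to 1.\<close>

lemma T_set'_subset_T_set: "T_set' r \<xi> \<subseteq> T_set r \<xi>"
proof
  fix \<tau> assume "\<tau> \<in> T_set' r \<xi>"
  then obtain L \<alpha> \<beta> where pos: "\<tau> > 0" and \<alpha>: "0 < \<alpha>" "\<alpha> < 1" and \<beta>: "1 < \<beta>"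
    and root: "(\<lambda>n. root n \<bar>form_eval r (L n) \<xi>\<bar>) \<longlonglongrightarrow> \<alpha>"
    and limsup: "limsup (\<lambda>n. ereal (root n (of_int (form_height r (L n))))) \<le> ereal \<beta>"
    and \<tau>: "\<tau> = - ln \<alpha> / ln \<beta>"
    unfolding T_set'_def by blast
  define x where "x n = \<bar>form_eval r (L n) \<xi>\<bar>" for n
  define h where "h n = real_of_int (form_height r (L n))" for n
  have x_upper: "\<forall>\<^sub>F n in sequentially. x n < a ^ n" if "\<alpha> < a" for a
  proof -
    have "\<forall>\<^sub>F n in sequentially. root n (x n) < a"
      using root that unfolding x_def by (rule order_tendstoD)
    with eventually_gt_at_top[of 0] show ?thesis
      by eventually_elim (auto intro: root_less_imp_less_power simp: x_def)
  qed
  have h_upper: "\<forall>\<^sub>F n in sequentially. h n < b ^ n" if "\<beta> < b" for b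
  proof -
    have "\<forall>\<^sub>F n in sequentially. ereal (root n (h n)) < ereal b"
      using limsup that unfolding h_def by (intro Limsup_lessD) (auto intro: le_less_trans)
    with eventually_gt_at_top[of 0] show ?thesis
      by eventually_elim (auto intro: root_less_imp_less_power simp: h_def form_height_nonneg)
  qed
  have x_pos: "\<forall>\<^sub>F n in sequentially. x n > 0"
  proof -
    have "\<forall>\<^sub>F n in sequentially. root n (x n) > 0"
      using root \<alpha>(1) unfolding x_def by (rule order_tendstoD)
    with eventually_gt_at_top[of 0] show ?thesis
      by eventually_elim simp
  qed
  obtain a where a: "\<alpha> < a" "a < 1"
    using \<alpha>(2) dense by blast
  have x_small: "\<forall>\<^sub>F n in sequentially. x n < 1"
    using x_upper[OF a(1)]
  proof eventually_elim
    case (elim n)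
    have "a ^ n \<le> 1" using a \<alpha> by (intro power_le_one) auto
    with elim show ?case by linarith
  qed
  have h_ge_1: "\<forall>\<^sub>F n in sequentially. 1 \<le> h n"
    using x_pos
  proof eventually_elim
    case (elim n)
    then have "1 \<le> form_height r (L n)"
      by (intro form_height_ge_1_if_eval) (auto simp: x_def)
    then show ?case by (simp add: h_def)
  qed
  have ln_lim: "(\<lambda>n. ln (x n) / real n) \<longlonglongrightarrow> ln \<alpha>"
  proof -
    have "(\<lambda>n. ln (root n (x n))) \<longlonglongrightarrow> ln \<alpha>"
      unfolding x_def using root \<alpha>(1) by (intro tendsto_ln) auto
    moreover have "\<forall>\<^sub>F n in sequentially. ln (root n (x n)) = ln (x n) / real n"
      using x_pos eventually_gt_at_top[of 0] by eventually_elim (simp add: ln_root)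
    ultimately show ?thesis by (rule Lim_transform_eventually)
  qed
  show "\<tau> \<in> T_set r \<xi>"
  proof (rule T_setI)
    show "\<tau> > 0" by fact
    show "\<forall>\<^sub>F n in sequentially. form_eval r (L n) \<xi> \<noteq> 0"
      using x_pos by eventually_elim (simp add: x_def)
    have "x \<longlonglongrightarrow> 0"
    proof (rule tendsto_sandwich[of "\<lambda>_. 0"])
      show "(\<lambda>n. a ^ n) \<longlonglongrightarrow> 0"
        using a \<alpha> by (intro LIMSEQ_realpow_zero) auto
      show "\<forall>\<^sub>F n in sequentially. x n \<le> a ^ n"
        using x_upper[OF a(1)] by eventually_elim simp
    qed (auto simp: x_def)
    then show "(\<lambda>n. form_eval r (L n) \<xi>) \<longlonglongrightarrow> 0"
      unfolding x_def by (rule tendsto_rabs_zero_cancel)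
    have "eq_pow_o1 (\<lambda>n. x (Suc n)) x 1"
    proof (rule eq_pow_o1I)
      have "(\<lambda>n. (ln (x (Suc n)) / real (Suc n)) / (ln (x n) / real n) * (real (Suc n) / real n))
          \<longlonglongrightarrow> ln \<alpha> / ln \<alpha> * 1"
        using \<alpha> by (intro tendsto_intros ln_lim LIMSEQ_Suc[OF ln_lim] LIMSEQ_Suc_n_over_n) auto
      then have "(\<lambda>n. (ln (x (Suc n)) / real (Suc n)) / (ln (x n) / real n) * (real (Suc n) / real n))
          \<longlonglongrightarrow> 1"
        using \<alpha> by simp
      moreover have "\<forall>\<^sub>F n in sequentially.
          (ln (x (Suc n)) / real (Suc n)) / (ln (x n) / real n) * (real (Suc n) / real n)
          = ln (x (Suc n)) / ln (x n)"
        using eventually_gt_at_top[of 0] by eventually_elim (simp add: divide_simps del: of_nat_Suc)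
      ultimately show "(\<lambda>n. ln (x (Suc n)) / ln (x n)) \<longlonglongrightarrow> 1"
        by (rule Lim_transform_eventually)
      show "\<forall>\<^sub>F n in sequentially. 0 < x n \<and> x n \<noteq> 1"
        using x_pos x_small by eventually_elim simp
      show "\<forall>\<^sub>F n in sequentially. 0 < x (Suc n)"
        using x_pos by (subst eventually_sequentially_Suc)
    qed
    then show "eq_pow_o1 (\<lambda>n. \<bar>form_eval r (L (Suc n)) \<xi>\<bar>) (\<lambda>n. \<bar>form_eval r (L n) \<xi>\<bar>) 1"
      by (simp add: x_def[abs_def])
    have "le_pow_o1 x h (- \<tau>)"
    proof (rule le_pow_o1I)
      fix \<epsilon> :: real assume "\<epsilon> > 0"
      \<comment> \<open>Keeping \<open>e\<close> below \<open>\<tau>\<close> makes the exponent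
        \<open>- \<tau> + e\<close> negative, so that an upper bound for the height becomes a lower
        bound for its power.\<close>
      define e where "e = min \<epsilon> (\<tau> / 2)"
      have e: "0 < e" "e \<le> \<epsilon>" "e < \<tau>"
        using \<open>\<epsilon> > 0\<close> pos by (auto simp: e_def)
      \<comment> \<open>A base slightly above \<beta> is needed to bound the heights strictly. With
        \<open>e / 2\<close> in the denominator, \<open>b powr (- \<tau> + e)\<close> is still
        larger than \<alpha> = \<open>\<beta> powr (- \<tau>)\<close>, leaving room for the values
        as well.\<close>
      define b where "b = \<beta> powr (\<tau> / (\<tau> - e / 2))"
      have ln_b: "ln b = \<tau> / (\<tau> - e / 2) * ln \<beta>"
        using \<beta> by (simp add: b_def ln_powr)
      have b: "\<beta> < b" "1 < b"
      proof -
        have "\<beta> powr 1 < b"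
          unfolding b_def using e \<beta> by (intro powr_less_mono) (auto simp: field_simps)
        then show "\<beta> < b" "1 < b" using \<beta> by auto
      qed
      have "\<alpha> < b powr (- \<tau> + e)"
      proof -
        have "ln \<alpha> = - (\<tau> * ln \<beta>)"
          using \<beta> by (simp add: \<tau>)
        moreover have "(\<tau> - e) * (\<tau> / (\<tau> - e / 2)) < \<tau>"
          using e by (simp add: field_simps)
        then have "(\<tau> - e) * (\<tau> / (\<tau> - e / 2)) * ln \<beta> < \<tau> * ln \<beta>"
          using \<beta> by (intro mult_strict_right_mono) auto
        moreover have "(- \<tau> + e) * (k * ln \<beta>) = - ((\<tau> - e) * k * ln \<beta>)" for k
          by (simp add: algebra_simps)
        ultimately have "ln \<alpha> < (- \<tau> + e) * ln b"
          unfolding ln_b by simp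
        also have "\<dots> = ln (b powr (- \<tau> + e))"
          using b by (simp add: ln_powr)
        finally show ?thesis
          using \<alpha> b by (subst (asm) ln_less_cancel_iff) auto
      qed
      from x_upper[OF this] h_upper[OF b(1)] h_ge_1
      show "\<forall>\<^sub>F n in sequentially. x n \<le> h n powr (- \<tau> + \<epsilon>)"
      proof eventually_elim
        case (elim n)
        have "x n \<le> (b powr (- \<tau> + e)) ^ n"
          using elim by simp
        also have "\<dots> = (b ^ n) powr (- \<tau> + e)"
          using b by (simp add: powr_powr powr_realpow[symmetric] mult.commute)
        also have "\<dots> \<le> h n powr (- \<tau> + e)"
          using elim e by (intro powr_mono2') auto
        also have "\<dots> \<le> h n powr (- \<tau> + \<epsilon>)"
          using elim e by (intro powr_mono) auto
        finally show ?case .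
      qed
    qed (fact h_ge_1)
    then show "le_pow_o1 (\<lambda>n. \<bar>form_eval r (L n) \<xi>\<bar>) (\<lambda>n. of_int (form_height r (L n))) (- \<tau>)"
      by (simp add: x_def[abs_def] h_def[abs_def])
  qed
qed

section \<open>Forms against simultaneous approximations\<close>

text \<open>If \<open>L\<close> does not vanish at \<open>q\<close>, then \<open>\<bar>L(q)\<bar> \<ge> 1\<close>, since it is an integer;
  otherwise \<open>q\<^sub>k L(\<xi>)\<close> itself is small.\<close>

lemma form_dichotomy:
  fixes q L :: "nat \<Rightarrow> int"
  assumes k: "k \<le> r" and q: "\<And>i. i \<le> r \<Longrightarrow> \<bar>of_int (q i) * \<xi> k - of_int (q k) * \<xi> i\<bar> \<le> d"
  defines "B \<equiv> real (Suc r) * of_int (form_height r L) * d"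
  shows "\<bar>of_int (q k)\<bar> * \<bar>form_eval r L \<xi>\<bar> \<le> B
    \<or> \<bar>\<xi> k\<bar> \<le> \<bar>of_int (q k)\<bar> * \<bar>form_eval r L \<xi>\<bar> + B"
proof -
  define m where "m = (\<Sum>i\<le>r. L i * q i)"
  \<comment> \<open>By linearity the difference is the form evaluated at the tuple of cross
    differences, each of which is at most \<open>d\<close>.\<close>
  have "of_int m * \<xi> k - of_int (q k) * form_eval r L \<xi>
      = form_eval r L (\<lambda>i. of_int (q i) * \<xi> k - of_int (q k) * \<xi> i)"
    by (simp add: m_def form_eval_def sum_distrib_left sum_distrib_right sum_subtractf algebra_simps)
  then have *: "\<bar>of_int m * \<xi> k - of_int (q k) * form_eval r L \<xi>\<bar> \<le> B"
    using abs_form_eval_le[OF q] unfolding B_def by presburger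
  show ?thesis
  proof (cases "m = 0")
    case True
    with * show ?thesis by (simp add: abs_mult)
  next
    case False
    then have "1 * \<bar>\<xi> k\<bar> \<le> \<bar>of_int m\<bar> * \<bar>\<xi> k\<bar>"
      by (intro mult_right_mono) linarith+
    with * show ?thesis
      unfolding abs_mult[symmetric] by linarith
  qed
qed

lemma T_set_times_exponent_le_1:
  assumes \<tau>: "\<tau> \<in> T_set r \<xi>" and k: "k \<le> r" "\<xi> k \<noteq> 0" and "\<omega> > 0"
    and inf: "infinite {q \<in> {..r} \<rightarrow>\<^sub>E (UNIV :: int set).
       \<forall>i j. i < j \<and> j \<le> r \<longrightarrow>
         \<bar>of_int (q i) * \<xi> j - of_int (q j) * \<xi> i\<bar>
           \<le> of_int (MAX k\<in>{..r}. \<bar>q k\<bar>) powr (- \<omega>)}" (is "infinite ?S")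
  shows "\<tau> * \<omega> \<le> 1"
proof (rule ccontr)
  assume contra: "\<not> \<tau> * \<omega> \<le> 1"
  obtain L where pos: "\<tau> > 0"
    and nz: "\<And>n. form_eval r (L n) \<xi> \<noteq> 0"
    and lim: "(\<lambda>n. form_eval r (L n) \<xi>) \<longlonglongrightarrow> 0"
    and eq: "eq_pow_o1 (\<lambda>n. \<bar>form_eval r (L (Suc n)) \<xi>\<bar>) (\<lambda>n. \<bar>form_eval r (L n) \<xi>\<bar>) 1"
    and le: "le_pow_o1 (\<lambda>n. \<bar>form_eval r (L n) \<xi>\<bar>) (\<lambda>n. of_int (form_height r (L n))) (- \<tau>)"
    using \<tau> unfolding T_set_def by blast
  define x where "x n = \<bar>form_eval r (L n) \<xi>\<bar>" for n
  define h where "h n = real_of_int (form_height r (L n))" for n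
  have x_pos: "x n > 0" for n
    using nz by (simp add: x_def)
  have h_ge_1: "1 \<le> h n" for n
    using form_height_ge_1_if_eval[OF nz, of n] by (simp add: h_def)
  have x_lim: "x \<longlonglongrightarrow> 0"
    using lim unfolding x_def by (rule tendsto_rabs_zero)
  \<comment> \<open>At \<open>e = 0\<close> the last inequality reads 1 / \<tau> < \<omega>, which
    is the negated claim. By continuity it persists for small positive \<open>e\<close>, which
    replaces all o(1) terms below.\<close>
  obtain e where e: "0 < e" "e < \<tau>" "(1 + e) / (\<tau> - e) + e < \<omega>"
  proof -
    have "((\<lambda>e. (1 + e) / (\<tau> - e) + e) \<longlongrightarrow> (1 + 0) / (\<tau> - 0) + 0) (at_right 0)"
      using pos by (intro tendsto_intros) auto
    moreover have "(1 + 0) / (\<tau> - 0) + 0 < \<omega>"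
      using contra pos by (simp add: field_simps)
    ultimately have "\<forall>\<^sub>F e in at_right 0. (1 + e) / (\<tau> - e) + e < \<omega>"
      by (rule order_tendstoD)
    moreover have "\<forall>\<^sub>F e in at_right 0. 0 < e \<and> e < \<tau>"
      using eventually_at_right_real[OF pos] by (auto elim: eventually_mono)
    ultimately have "\<forall>\<^sub>F e in at_right 0. (1 + e) / (\<tau> - e) + e < \<omega> \<and> 0 < e \<and> e < \<tau>"
      by (rule eventually_conj)
    then show ?thesis
      using that eventually_happens'[OF trivial_limit_at_right_real] by blast
  qed
  define \<kappa> where "\<kappa> = (1 + e) / (\<tau> - e)"
  have x_lt_1: "\<forall>\<^sub>F n in sequentially. x n < 1"
    using x_lim by (rule order_tendstoD) simp
  \<comment> \<open>This keeps the values from dropping too fast, so that they cannot jump far below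
    a given threshold in one step.\<close>
  have x_step: "\<forall>\<^sub>F n in sequentially. x n powr (1 + e) \<le> x (Suc n)"
  proof -
    have "\<forall>\<^sub>F n in sequentially. \<bar>form_eval r (L n) \<xi>\<bar> > 0 \<and> \<bar>form_eval r (L n) \<xi>\<bar> \<noteq> 1"
      using x_lt_1 by eventually_elim (use nz in \<open>auto simp: x_def\<close>)
    from eq_pow_o1D[OF eq this]
    have "(\<lambda>n. ln (x (Suc n)) / ln (x n)) \<longlonglongrightarrow> 1"
      by (simp add: x_def)
    then have "\<forall>\<^sub>F n in sequentially. ln (x (Suc n)) / ln (x n) < 1 + e"
      using e(1) by (intro order_tendstoD) auto
    with x_lt_1 show ?thesis
    proof eventually_elim
      case (elim n)
      have "ln (x n) < 0"
        using elim(1) x_pos by simp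
      then have "(1 + e) * ln (x n) \<le> ln (x (Suc n))"
        using elim(2) by (simp add: neg_divide_less_eq)
      then show ?case
        using x_pos[of n] x_pos[of "Suc n"] by (simp add: powr_def ln_ge_iff[symmetric])
    qed
  qed
  have x_le: "\<forall>\<^sub>F n in sequentially. x n \<le> h n powr (- (\<tau> - e))"
    using le_pow_o1D[OF le _ e(1)] h_ge_1 by (simp add: x_def[abs_def] h_def[abs_def])
  obtain N where N: "\<And>n. n \<ge> N \<Longrightarrow> x n powr (1 + e) \<le> x (Suc n)"
      "\<And>n. n \<ge> N \<Longrightarrow> x n \<le> h n powr (- (\<tau> - e))"
    using eventually_conj[OF x_step x_le] unfolding eventually_sequentially by blast
  \<comment> \<open>Half of \<open>\<bar>\<xi> k\<bar>\<close> is spent twice: on the term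
    \<open>\<bar>q k\<bar> * x n\<close> when the form is nonzero at \<open>q\<close>, and on the
    approximation error when \<open>\<bar>q k\<bar>\<close> is compared with the height.\<close>
  define c where "c = \<bar>\<xi> k\<bar> / 2"
  define X where "X = (\<Sum>i\<le>r. \<bar>\<xi> i\<bar>)"
  have X: "\<bar>\<xi> i\<bar> \<le> X" if "i \<le> r" for i
    unfolding X_def using that by (intro member_le_sum) auto
  have c: "c > 0"
    using k by (simp add: c_def)
  have X_pos: "X > 0"
    using X[OF k(1)] c by (simp add: c_def)
  \<comment> \<open>\<open>A * Q powr (- e)\<close> will bound \<open>\<bar>q k\<bar> * x n\<close>
    from below, and \<open>B * Q powr (\<kappa> - \<omega>)\<close> will bound the error term of the
    dichotomy from above. For large \<open>Q\<close> these bounds are incompatible.\<close>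
  define A where "A = c / X * c powr (1 + e)"
  define B where "B = real (Suc r) * c powr (- \<kappa>)"
  have A: "A > 0"
    using c X_pos by (simp add: A_def)
  have "\<forall>\<^sub>F Q in at_top. B * Q powr (\<kappa> + e - \<omega>) < min A c"
  proof -
    have "((\<lambda>Q. B * Q powr (\<kappa> + e - \<omega>)) \<longlongrightarrow> B * 0) at_top"
      using e(3) by (intro tendsto_intros tendsto_neg_powr filterlim_ident) (auto simp: \<kappa>_def)
    then show ?thesis
      by (rule order_tendstoD) (use A c in simp)
  qed
  \<comment> \<open>The bound \<open>1 / c\<close> absorbs an additive error 1, and
    \<open>c / x N\<close> prevents index \<open>N\<close> itself from lying below the threshold
    \<open>c / Q\<close>.\<close>
  moreover have "\<forall>\<^sub>F Q in at_top. Q \<ge> 1 \<and> Q \<ge> 1 / c \<and> Q \<ge> c / x N"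
    by (intro eventually_conj eventually_ge_at_top)
  ultimately obtain Q0 where Q0: "\<And>Q. Q \<ge> Q0 \<Longrightarrow> B * Q powr (\<kappa> + e - \<omega>) < min A c"
      "\<And>Q. Q \<ge> Q0 \<Longrightarrow> Q \<ge> 1 \<and> Q \<ge> 1 / c \<and> Q \<ge> c / x N"
    unfolding eventually_at_top_linorder by (metis max.bounded_iff nle_le)
  obtain q where q: "q \<in> ?S" "form_height r q > \<lceil>Q0\<rceil>"
  proof -
    have "\<not> ?S \<subseteq> {q \<in> {..r} \<rightarrow>\<^sub>E UNIV. form_height r q \<le> \<lceil>Q0\<rceil>}"
      using inf finite_subset[OF _ finite_bounded_height] by blast
    then obtain q where "q \<in> ?S" "q \<notin> {q \<in> {..r} \<rightarrow>\<^sub>E UNIV. form_height r q \<le> \<lceil>Q0\<rceil>}"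
      by blast
    then show ?thesis by (intro that[of q]) (simp_all add: not_le)
  qed
  define Q where "Q = real_of_int (form_height r q)"
  have "Q \<ge> Q0"
    using q(2) unfolding Q_def by linarith
  note Q = Q0[OF this]
  define d where "d = Q powr (- \<omega>)"
  have approx: "\<bar>of_int (q i) * \<xi> k - of_int (q k) * \<xi> i\<bar> \<le> d" if "i \<le> r" for i
  proof -
    have *: "\<bar>of_int (q i) * \<xi> j - of_int (q j) * \<xi> i\<bar> \<le> d" if "i < j" "j \<le> r" for i j
      using q(1) that by (auto simp: d_def Q_def form_height_def)
    show ?thesis
    proof (cases i k rule: linorder_cases)
      case less
      then show ?thesis using *[of i k] k by simp
    next
      case equal
      then show ?thesis by (simp add: d_def)
    next
      case greater
      then show ?thesis using *[of k i] that by (simp add: abs_minus_commute)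
    qed
  qed
  have "\<exists>n\<ge>N. x n < c / Q"
  proof -
    have "\<forall>\<^sub>F n in sequentially. x n < c / Q"
      using x_lim by (rule order_tendstoD) (use c Q in simp)
    with eventually_ge_at_top[of N] have "\<forall>\<^sub>F n in sequentially. n \<ge> N \<and> x n < c / Q"
      by eventually_elim simp
    then show ?thesis
      using eventually_happens'[OF sequentially_bot] by blast
  qed
  then have "\<exists>n. N \<le> n \<and> x n < c / Q" by blast
  from LeastI_ex[OF this] not_less_Least[of _ "\<lambda>n. N \<le> n \<and> x n < c / Q"]
  obtain n where n: "N \<le> n" "x n < c / Q" "\<And>m. m < n \<Longrightarrow> N \<le> m \<Longrightarrow> c / Q \<le> x m"
    by (metis not_le)
  \<comment> \<open>The first index below the threshold thus has a predecessor \<open>m\<close> in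
    the range where the estimates hold, with \<open>x m\<close> still at least \<open>c / Q\<close>.
    This yields the lower bound on \<open>x n\<close>.\<close>
  have "n \<noteq> N"
  proof
    assume "n = N"
    then have "x N < c / Q" using n(2) by simp
    moreover have "c / Q \<le> x N"
      using Q(2) x_pos[of N] by (simp add: field_simps)
    ultimately show False by simp
  qed
  with n(1) obtain m where m: "n = Suc m" "N \<le> m"
    by (cases n) auto
  have x_lower: "(c / Q) powr (1 + e) \<le> x n"
  proof -
    have "(c / Q) powr (1 + e) \<le> x m powr (1 + e)"
      using n(3)[of m] m c Q e by (intro powr_mono2) auto
    with N(1)[OF m(2)] m show ?thesis by simp
  qed
  \<comment> \<open>The value is at most a negative power of the height, so its lower bound limits
    the height. Raising to the negative power \<open>- (1 / (\<tau> - e))\<close> reverses the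
    inequality.\<close>
  have h_upper: "h n \<le> (c / Q) powr (- \<kappa>)"
  proof -
    have "(c / Q) powr (1 + e) \<le> h n powr (- (\<tau> - e))"
      using x_lower N(2)[OF n(1)] by linarith
    then have "(h n powr (- (\<tau> - e))) powr (- (1 / (\<tau> - e)))
        \<le> ((c / Q) powr (1 + e)) powr (- (1 / (\<tau> - e)))"
      using e c Q by (intro powr_mono2') auto
    moreover have "- (\<tau> - e) * - (1 / (\<tau> - e)) = 1" "(1 + e) * - (1 / (\<tau> - e)) = - \<kappa>"
      using e by (simp_all add: \<kappa>_def field_simps)
    ultimately show ?thesis
      using h_ge_1[of n] by (simp add: powr_powr)
  qed
  have rhs: "real (Suc r) * h n * d \<le> B * Q powr (\<kappa> - \<omega>)"
  proof -
    have "real (Suc r) * h n * d \<le> real (Suc r) * (c / Q) powr (- \<kappa>) * d"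
      using h_upper by (intro mult_right_mono mult_left_mono) (auto simp: d_def)
    also have "\<dots> = B * Q powr (\<kappa> - \<omega>)"
      using c Q by (simp add: B_def d_def powr_divide powr_diff powr_minus field_simps)
    finally show ?thesis .
  qed
  from form_dichotomy[where q = q and \<xi> = \<xi> and d = d and L = "L n", OF k(1) approx]
  consider "\<bar>of_int (q k)\<bar> * x n \<le> real (Suc r) * h n * d"
    | "\<bar>\<xi> k\<bar> \<le> \<bar>of_int (q k)\<bar> * x n + real (Suc r) * h n * d"
    unfolding x_def h_def by blast
  then show False
  proof cases
    \<comment> \<open>Here \<open>\<bar>q k\<bar>\<close> must be shown comparable to the height
      \<open>Q\<close>. Comparison with a coordinate \<open>i\<close> attaining the height gives
      \<open>Q * \<bar>\<xi> k\<bar> \<le> \<bar>q k\<bar> * X + 1\<close>, where the 1 is at most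
      half of the left side.\<close>
    case 1
    obtain i where i: "i \<le> r" "\<bar>q i\<bar> = form_height r q"
      using form_height_attained by blast
    have "Q = \<bar>of_int (q i)\<bar>"
      using i(2) unfolding Q_def by (metis of_int_abs)
    moreover have "d \<le> 1"
      unfolding d_def using Q(2) \<open>\<omega> > 0\<close> powr_mono[of "- \<omega>" 0 Q] by simp
    moreover have "\<bar>of_int (q k) * \<xi> i\<bar> \<le> \<bar>of_int (q k)\<bar> * X"
      using X[OF i(1)] by (simp add: abs_mult mult_left_mono)
    ultimately have "Q * \<bar>\<xi> k\<bar> \<le> \<bar>of_int (q k)\<bar> * X + 1"
      using approx[OF i(1)] by (simp only: abs_mult[symmetric])
    moreover have "1 \<le> Q * c"
      using Q(2) c by (simp add: field_simps)
    ultimately have "Q * c \<le> \<bar>of_int (q k)\<bar> * X"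
      by (simp add: c_def)
    then have "c / X * Q \<le> \<bar>of_int (q k)\<bar>"
      using X_pos by (simp add: field_simps)
    then have "c / X * Q * (c / Q) powr (1 + e) \<le> \<bar>of_int (q k)\<bar> * x n"
      using x_lower c X_pos Q by (intro mult_mono) auto
    also have "\<dots> \<le> B * Q powr (\<kappa> - \<omega>)"
      using 1 rhs by linarith
    finally have "c / X * Q * (c / Q) powr (1 + e) * Q powr e \<le> B * Q powr (\<kappa> - \<omega>) * Q powr e"
      by (intro mult_right_mono) auto
    also have "\<dots> = B * Q powr (\<kappa> + e - \<omega>)"
      by (simp add: powr_add powr_diff)
    also have "c / X * Q * (c / Q) powr (1 + e) * Q powr e = A"
      using c Q by (simp add: A_def powr_divide powr_add)
    finally show False using Q(1) by simp
  next
    case 2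
    have "\<bar>of_int (q k)\<bar> * x n \<le> Q * (c / Q)"
    proof (intro mult_mono)
      show "\<bar>real_of_int (q k)\<bar> \<le> Q"
        using abs_le_form_height[OF k(1), of q] unfolding Q_def by linarith
    qed (use n(2) x_pos[of n] Q in auto)
    then have "\<bar>of_int (q k)\<bar> * x n \<le> c"
      using Q by simp
    then have "c \<le> B * Q powr (\<kappa> - \<omega>)"
      using 2 rhs by (simp add: c_def)
    also have "\<dots> \<le> B * Q powr (\<kappa> + e - \<omega>)"
      using Q e by (intro mult_left_mono powr_mono) (auto simp: B_def)
    finally show False using Q(1) by simp
  qed
qed

section \<open>Simultaneous approximation\<close>

interpretation rat: vector_space rat_scale
  by (rule vector_space_rat_scale)

lemma common_denominator:
  fixes F :: "rat set"
  assumes "finite F"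
  shows "\<exists>D::int. D > 0 \<and> (\<forall>c\<in>F. of_int D * c \<in> \<int>)"
  using assms
proof induction
  case empty
  show ?case by (intro exI[of _ 1]) simp
next
  case (insert c F)
  then obtain D where D: "D > 0" "\<forall>c\<in>F. of_int D * c \<in> \<int>" by blast
  obtain a b where c: "c = Fract a b" "b > 0"
    by (cases c)
  have "of_int (D * b) * c = of_int (D * a)"
    using c by (simp add: Fract_of_int_quotient)
  moreover have "of_int (D * b) * c' \<in> \<int>" if "c' \<in> F" for c'
  proof -
    have "of_int (D * b) * c' = of_int b * (of_int D * c')" by simp
    with D that show ?thesis by (metis Ints_mult Ints_of_int)
  qed
  ultimately show ?case
    using D c by (intro exI[of _ "D * b"]) (metis Ints_of_int insert_iff mult_pos_pos)
qed

text \<open>A common denominator \<open>D\<close> makes the coordinates integral, so that integers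
  approximating multiples of the basis elements combine to integers approximating multiples of each
  \<open>v\<close>.\<close>

lemma integer_coordinates:
  assumes "finite B" "finite V" "V \<subseteq> rat_span B"
  obtains D :: int and A :: "real \<Rightarrow> real \<Rightarrow> int"
  where "D > 0" "\<And>v. v \<in> V \<Longrightarrow> of_int D * v = (\<Sum>b\<in>B. of_int (A v b) * b)"
proof -
  have "\<forall>v\<in>V. \<exists>c. v = (\<Sum>b\<in>B. of_rat (c b) * b)"
    using assms(3) unfolding rat_span_def rat.span_finite[OF assms(1)] rat_scale_def by blast
  then obtain c where c: "\<And>v. v \<in> V \<Longrightarrow> v = (\<Sum>b\<in>B. of_rat (c v b) * b)"
    by metis
  have "finite ((\<lambda>(v, b). c v b) ` (V \<times> B))"
    using assms by simp
  from common_denominator[OF this] obtain D where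
    D: "D > 0" "\<And>v b. v \<in> V \<Longrightarrow> b \<in> B \<Longrightarrow> of_int D * c v b \<in> \<int>"
    by auto
  show ?thesis
  proof
    fix v assume v: "v \<in> V"
    have "of_int D * v = (\<Sum>b\<in>B. of_int D * (of_rat (c v b) * b))"
      using c[OF v] by (metis sum_distrib_left)
    also have "\<dots> = (\<Sum>b\<in>B. of_int \<lfloor>of_int D * c v b\<rfloor> * b)"
    proof (rule sum.cong)
      fix b assume "b \<in> B"
      then have "of_int \<lfloor>of_int D * c v b\<rfloor> = of_int D * c v b"
        using D(2)[OF v] by simp
      then have "(of_int \<lfloor>of_int D * c v b\<rfloor> :: real) = of_int D * of_rat (c v b)"
        by (metis of_rat_mult of_rat_of_int_eq)
      then show "of_int D * (of_rat (c v b) * b) = of_int \<lfloor>of_int D * c v b\<rfloor> * b"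
        by simp
    qed simp
    finally show "of_int D * v = (\<Sum>b\<in>B. of_int \<lfloor>of_int D * c v b\<rfloor> * b)" .
  qed (fact D(1))
qed

text \<open>Dirichlet's theorem is applied to the ratios \<open>b / b\<^sub>0\<close> of the elements of a basis; integer
  coordinates carry the resulting approximation over to all of \<open>\<xi>\<close>.\<close>

lemma simultaneous_approximation:
  assumes B: "finite B" "b0 \<in> B" "b0 \<noteq> 0" "card B = Suc d"
    and \<xi>: "B \<subseteq> \<xi> ` {..r}" "\<xi> ` {..r} \<subseteq> rat_span B"
  obtains C where "C > 0"
    "\<And>N::nat. real N \<ge> C \<Longrightarrow> \<exists>q \<in> {..r} \<rightarrow>\<^sub>E (UNIV :: int set). (\<exists>i\<le>r. q i \<noteq> 0) \<and>
      of_int (form_height r q) \<le> C * real N ^ d \<and>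
      (\<forall>i\<le>r. \<forall>j\<le>r. \<bar>of_int (q i) * \<xi> j - of_int (q j) * \<xi> i\<bar> \<le> C / real N)"
proof -
  obtain D A where D: "D > 0"
    and A: "\<And>v. v \<in> \<xi> ` {..r} \<Longrightarrow> of_int D * v = (\<Sum>b\<in>B. of_int (A v b) * b)"
    using integer_coordinates[OF B(1) _ \<xi>(2)] by blast
  define M where "M = (\<Sum>i\<le>r. \<Sum>b\<in>B. \<bar>real_of_int (A (\<xi> i) b)\<bar>)"
  define X where "X = (\<Sum>i\<le>r. \<bar>\<xi> i\<bar>)"
  \<comment> \<open>The constant adds up three demands: \<open>M\<close> below \<open>N\<close> for
    a nonzero tuple, the height bound, and the bound \<open>2 * M * X\<close> on the cross
    differences.\<close>
  define C where "C = M + of_int D * X / \<bar>b0\<bar> + 2 * M * X + 1"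
  have nonneg: "M \<ge> 0" "X \<ge> 0"
    unfolding M_def X_def by (auto intro!: sum_nonneg)
  have X: "\<bar>\<xi> i\<bar> \<le> X" if "i \<le> r" for i
    unfolding X_def using that by (intro member_le_sum) auto
  have terms_nonneg: "0 \<le> of_int D * X / \<bar>b0\<bar>" "0 \<le> 2 * M * X"
    using nonneg D by auto
  have C: "C \<ge> 1"
    using nonneg terms_nonneg unfolding C_def by linarith
  \<comment> \<open>The ratio of \<open>b0\<close> to itself is 1 and needs no approximation. Only
    \<open>d\<close> ratios remain, whence the exponent \<open>d\<close> in the height
    bound.\<close>
  have "card (B - {b0}) = d"
    using B by simp
  then obtain g where g: "bij_betw g {..<d} (B - {b0})"
    using ex_bij_betw_nat_finite[of "B - {b0}"] B(1) by (auto simp: atLeast0LessThan)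
  show ?thesis
  proof
    show "C > 0" using C by simp
    fix N :: nat assume N: "real N \<ge> C"
    have N1: "real N \<ge> 1" using N C by linarith
    then have "N > 0" by linarith
    then obtain q0 p where q0: "0 < q0" "q0 \<le> int (N ^ d)"
      and p: "\<And>i. i < d \<Longrightarrow> \<bar>of_int q0 * (g i / b0) - of_int (p i)\<bar> < 1 / N"
      using Dirichlet_approx_simult[of N d "\<lambda>i. g i / b0"] by metis
    define P where "P b = (if b = b0 then q0 else p (inv_into {..<d} g b))" for b
    have P: "\<bar>of_int (P b) - of_int q0 * (b / b0)\<bar> \<le> 1 / N" if b: "b \<in> B" for b
    proof (cases "b = b0")
      case True
      then show ?thesis using B by (simp add: P_def)
    next
      case False
      with b g have "b \<in> g ` {..<d}"
        by (simp add: bij_betw_def)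
      then obtain i where i: "i < d" "g i = b"
        by auto
      then have "inv_into {..<d} g b = i"
        using g by (metis bij_betw_imp_inj_on inv_into_f_f lessThan_iff)
      then show ?thesis
        using False p[OF i(1)] i(2) by (simp add: P_def abs_minus_commute)
    qed
    \<comment> \<open>Since \<open>P b\<close> is close to \<open>q0 * b / b0\<close>, the integer
      combination \<open>q i\<close> is close to \<open>q0 / b0\<close> times
      \<open>D * \<xi> i\<close>, and \<open>\<mu>\<close> is the common factor.\<close>
    define \<mu> where "\<mu> = of_int q0 * of_int D / b0"
    define q where "q = (\<lambda>i\<in>{..r}. \<Sum>b\<in>B. A (\<xi> i) b * P b)"
    define f where "f i = of_int (q i) - \<mu> * \<xi> i" for i
    have f: "\<bar>f i\<bar> \<le> M / N" if i: "i \<le> r" for i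
    proof -
      have "\<mu> * \<xi> i = of_int q0 / b0 * (of_int D * \<xi> i)"
        by (simp add: \<mu>_def)
      also have "\<dots> = (\<Sum>b\<in>B. of_int (A (\<xi> i) b) * (of_int q0 * (b / b0)))"
        using i by (subst A) (auto simp: sum_distrib_left mult_ac intro!: sum.cong)
      finally have "f i = (\<Sum>b\<in>B. of_int (A (\<xi> i) b) * (of_int (P b) - of_int q0 * (b / b0)))"
        using i by (simp add: f_def q_def sum_subtractf right_diff_distrib)
      also have "\<bar>\<dots>\<bar> \<le> (\<Sum>b\<in>B. \<bar>of_int (A (\<xi> i) b)\<bar> * \<bar>of_int (P b) - of_int q0 * (b / b0)\<bar>)"
        unfolding abs_mult[symmetric] by (rule sum_abs)
      also have "\<dots> \<le> (\<Sum>b\<in>B. \<bar>of_int (A (\<xi> i) b)\<bar> * (1 / N))"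
        using P by (intro sum_mono mult_left_mono) auto
      also have "\<dots> = (\<Sum>b\<in>B. \<bar>of_int (A (\<xi> i) b)\<bar>) * (1 / N)"
        by (rule sum_distrib_right[symmetric])
      also have "\<dots> \<le> M * (1 / N)"
        unfolding M_def using i by (intro mult_right_mono member_le_sum) (auto intro: sum_nonneg)
      finally show ?thesis by simp
    qed
    have MN: "M / N < 1"
    proof -
      have "M < real N"
        using N nonneg terms_nonneg unfolding C_def by linarith
      then show ?thesis using N1 by (simp add: field_simps)
    qed
    have Nd: "1 \<le> real N ^ d"
      using N1 by (rule one_le_power)
    \<comment> \<open>At an index where \<open>\<xi> i = b0\<close>, the approximated number is the
      positive integer \<open>q0 * D\<close>, while the error is below 1.\<close>
    have "\<exists>i\<le>r. q i \<noteq> 0"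
    proof -
      obtain i where i: "i \<le> r" "\<xi> i = b0"
        using B \<xi> by auto
      have "q0 * D \<ge> 1" using q0 D by (simp add: int_one_le_iff_zero_less)
      then have "real_of_int (q0 * D) \<ge> 1" by linarith
      then have "\<mu> * \<xi> i \<ge> 1"
        using i B by (simp add: \<mu>_def)
      then have "q i \<noteq> 0"
        using f[OF i(1)] MN by (auto simp: f_def)
      with i show ?thesis by blast
    qed
    moreover have "of_int (form_height r q) \<le> C * real N ^ d"
    proof -
      obtain i where i: "i \<le> r" "\<bar>q i\<bar> = form_height r q"
        using form_height_attained by blast
      have "of_int (form_height r q) = \<bar>of_int (q i) :: real\<bar>"
        using i(2) by (metis of_int_abs)
      also have "\<dots> \<le> \<bar>f i\<bar> + \<bar>\<mu>\<bar> * \<bar>\<xi> i\<bar>"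
        unfolding abs_mult[symmetric] f_def by linarith
      also have "\<dots> \<le> 1 + (real N ^ d * of_int D / \<bar>b0\<bar>) * X"
      proof (intro add_mono mult_mono)
        have "real_of_int q0 \<le> real N ^ d"
          using q0(2) by (metis of_int_le_iff of_int_of_nat_eq of_nat_power)
        then show "\<bar>\<mu>\<bar> \<le> real N ^ d * of_int D / \<bar>b0\<bar>"
          using q0 D by (simp add: \<mu>_def abs_mult divide_right_mono)
      qed (use f[OF i(1)] MN X[OF i(1)] D in auto)
      also have "\<dots> \<le> real N ^ d * (1 + of_int D * X / \<bar>b0\<bar>)"
        using Nd by (simp add: algebra_simps)
      also have "\<dots> \<le> real N ^ d * C"
        using Nd nonneg terms_nonneg unfolding C_def by (intro mult_left_mono) auto
      finally show ?thesis by (simp add: mult.commute)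
    qed
    moreover have "\<bar>of_int (q i) * \<xi> j - of_int (q j) * \<xi> i\<bar> \<le> C / real N" if ij: "i \<le> r" "j \<le> r" for i j
    proof -
      have "of_int (q i) * \<xi> j - of_int (q j) * \<xi> i = f i * \<xi> j - f j * \<xi> i"
        by (simp add: f_def algebra_simps)
      also have "\<bar>\<dots>\<bar> \<le> \<bar>f i\<bar> * \<bar>\<xi> j\<bar> + \<bar>f j\<bar> * \<bar>\<xi> i\<bar>"
        unfolding abs_mult[symmetric] by (rule abs_triangle_ineq4)
      also have "\<dots> \<le> M / N * X + M / N * X"
        using f X ij nonneg by (intro add_mono mult_mono) auto
      also have "\<dots> = (2 * M * X) / N"
        by simp
      also have "\<dots> \<le> C / N"
        using nonneg terms_nonneg unfolding C_def by (intro divide_right_mono) auto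
      finally show ?thesis .
    qed
    moreover have "q \<in> {..r} \<rightarrow>\<^sub>E UNIV"
      by (simp add: q_def)
    ultimately show "\<exists>q \<in> {..r} \<rightarrow>\<^sub>E (UNIV :: int set). (\<exists>i\<le>r. q i \<noteq> 0) \<and>
      of_int (form_height r q) \<le> C * real N ^ d \<and>
      (\<forall>i\<le>r. \<forall>j\<le>r. \<bar>of_int (q i) * \<xi> j - of_int (q j) * \<xi> i\<bar> \<le> C / real N)"
      by blast
  qed
qed

text \<open>Exact proportionality makes every \<open>\<xi> j\<close> a rational multiple of
  \<open>\<xi> i\<close>. With \<open>s\<close> positive this rules out both a nonzero tuple with
  zero error and the zero point.\<close>

lemma rat_dim_proportional_le_1:
  fixes q :: "nat \<Rightarrow> int"
  assumes "i \<le> r" "q i \<noteq> 0" "\<And>j. j \<le> r \<Longrightarrow> of_int (q i) * \<xi> j = of_int (q j) * \<xi> i"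
  shows "rat_dim (rat_span (\<xi> ` {..r})) \<le> 1"
proof -
  have "\<xi> j \<in> rat.span {\<xi> i}" if "j \<le> r" for j
  proof -
    have "\<xi> j = rat_scale (of_int (q j) / of_int (q i)) (\<xi> i)"
      using assms(2) assms(3)[OF that] by (simp add: rat_scale_def of_rat_divide field_simps)
    then show ?thesis by (metis rat.span_base rat.span_scale singletonI)
  qed
  then have "\<xi> ` {..r} \<subseteq> rat.span {\<xi> i}" by auto
  then have "rat.dim (\<xi> ` {..r}) \<le> card {\<xi> i}"
    by (rule rat.dim_le_card) simp
  then show ?thesis
    by (simp add: rat_dim_def rat_span_def)
qed

text \<open>Dirichlet's theorem might return the same tuple for many \<open>N\<close>. But no
  nonzero tuple is an exact approximation, so finitely many of them have errors bounded away from 0,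
  whereas the Dirichlet errors tend to 0.\<close>

lemma infinite_approximations:
  fixes r :: nat and \<xi> :: "nat \<Rightarrow> real"
  assumes dim: "rat_dim (rat_span (\<xi> ` {..r})) = Suc d" and "d > 0"
    and \<omega>: "0 < \<omega>" "\<omega> < 1 / real d"
  shows "infinite {q \<in> {..r} \<rightarrow>\<^sub>E (UNIV :: int set).
       \<forall>i j. i < j \<and> j \<le> r \<longrightarrow>
         \<bar>of_int (q i) * \<xi> j - of_int (q j) * \<xi> i\<bar>
           \<le> of_int (MAX k\<in>{..r}. \<bar>q k\<bar>) powr (- \<omega>)}" (is "infinite ?S")
proof
  assume fin: "finite ?S"
  obtain B where B: "B \<subseteq> \<xi> ` {..r}" "rat.independent B" "\<xi> ` {..r} \<subseteq> rat.span B"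
      "card B = rat.dim (\<xi> ` {..r})"
    by (rule rat.basis_exists)
  have card: "card B = Suc d"
    using dim B(4) by (simp add: rat_dim_def rat_span_def)
  have "finite B"
    using B(1) by (rule finite_subset) simp
  obtain b0 where "b0 \<in> B"
    using card by fastforce
  have "b0 \<noteq> 0"
    using \<open>b0 \<in> B\<close> B(2) rat.dependent_zero by blast
  have span: "\<xi> ` {..r} \<subseteq> rat_span B"
    using B(3) by (simp add: rat_span_def)
  obtain C where C: "C > 0" and approx:
    "\<And>N::nat. real N \<ge> C \<Longrightarrow> \<exists>q \<in> {..r} \<rightarrow>\<^sub>E (UNIV :: int set). (\<exists>i\<le>r. q i \<noteq> 0) \<and>
      of_int (form_height r q) \<le> C * real N ^ d \<and>
      (\<forall>i\<le>r. \<forall>j\<le>r. \<bar>of_int (q i) * \<xi> j - of_int (q j) * \<xi> i\<bar> \<le> C / real N)"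
    by (rule simultaneous_approximation[OF \<open>finite B\<close> \<open>b0 \<in> B\<close> \<open>b0 \<noteq> 0\<close> card B(1) span]) (rule that)
  define E where "E q = (\<Sum>i\<le>r. \<Sum>j\<le>r. \<bar>of_int (q i) * \<xi> j - of_int (q j) * \<xi> i\<bar>)" for q :: "nat \<Rightarrow> int"
  have E_pos: "E q > 0" if q: "i \<le> r" "q i \<noteq> 0" for q i
  proof (rule ccontr)
    assume "\<not> E q > 0"
    moreover have "E q \<ge> 0"
      unfolding E_def by (intro sum_nonneg) auto
    ultimately have "E q = 0" by simp
    then have "\<bar>of_int (q i) * \<xi> j - of_int (q j) * \<xi> i\<bar> = 0" if "i \<le> r" "j \<le> r" for i j
      using that unfolding E_def by (subst (asm) sum_nonneg_eq_0_iff) (auto intro: sum_nonneg simp: sum_nonneg_eq_0_iff)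
    then have "rat_dim (rat_span (\<xi> ` {..r})) \<le> 1"
      using q by (intro rat_dim_proportional_le_1[of i r q]) auto
    with dim \<open>d > 0\<close> show False by simp
  qed
  define K where "K = real (Suc r) * real (Suc r) * C"
  \<comment> \<open>The zero tuple lies in the set too, because \<open>0 powr (- \<omega>)\<close>
    is 0, and its total error is 0. It has to be left out here.\<close>
  have ev1: "\<forall>\<^sub>F N in sequentially. \<forall>q \<in> {q \<in> ?S. \<exists>i\<le>r. q i \<noteq> 0}. K / real N < E q"
  proof (rule eventually_ball_finite)
    show "finite {q \<in> ?S. \<exists>i\<le>r. q i \<noteq> 0}" by (rule finite_subset[OF _ fin]) blast
    show "\<forall>q \<in> {q \<in> ?S. \<exists>i\<le>r. q i \<noteq> 0}. \<forall>\<^sub>F N in sequentially. K / real N < E q"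
    proof
      fix q assume "q \<in> {q \<in> ?S. \<exists>i\<le>r. q i \<noteq> 0}"
      then have "E q > 0" using E_pos by blast
      moreover have "(\<lambda>N. K / real N) \<longlonglongrightarrow> 0"
        by (rule lim_const_over_n)
      ultimately show "\<forall>\<^sub>F N in sequentially. K / real N < E q"
        by (intro order_tendstoD)
    qed
  qed
  \<comment> \<open>This is the condition for the error bound \<open>C / N\<close> to lie below the
    power \<open>- \<omega>\<close> of the height bound \<open>C * N ^ d\<close>. It holds
    eventually because \<open>d * \<omega>\<close> is less than 1.\<close>
  have ev2: "\<forall>\<^sub>F N in sequentially. C powr (1 + \<omega>) * real N powr (d * \<omega> - 1) < 1"
  proof -
    have "d * \<omega> - 1 < 0"
      using \<omega> \<open>d > 0\<close> by (simp add: field_simps)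
    then have "(\<lambda>N. C powr (1 + \<omega>) * real N powr (d * \<omega> - 1)) \<longlonglongrightarrow> C powr (1 + \<omega>) * 0"
      by (intro tendsto_intros tendsto_neg_powr filterlim_real_sequentially)
    then show ?thesis
      by (rule order_tendstoD) simp
  qed
  have "\<forall>\<^sub>F N in sequentially. real N \<ge> C"
    using filterlim_at_top[THEN iffD1, rule_format, OF filterlim_real_sequentially] .
  with ev1 ev2 have "\<forall>\<^sub>F N in sequentially. False"
  proof eventually_elim
    case (elim N)
    have N: "real N > 0" using elim C by linarith
    obtain q i where q: "q \<in> {..r} \<rightarrow>\<^sub>E UNIV" "i \<le> r" "q i \<noteq> 0"
      and height: "of_int (form_height r q) \<le> C * real N ^ d"
      and small: "\<And>i j. i \<le> r \<Longrightarrow> j \<le> r \<Longrightarrow> \<bar>of_int (q i) * \<xi> j - of_int (q j) * \<xi> i\<bar> \<le> C / real N"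
      using approx[OF elim(3)] by blast
    have "E q \<le> (\<Sum>i\<le>r. \<Sum>j\<le>r. C / real N)"
      unfolding E_def using small by (intro sum_mono) auto
    then have "E q \<le> K / real N"
      by (simp add: K_def mult_ac)
    moreover have "C / real N \<le> of_int (form_height r q) powr (- \<omega>)"
    proof -
      have "1 \<le> form_height r q"
        using form_height_ge_1[of i r q] q by simp
      then have "(C * real N ^ d) powr (- \<omega>) \<le> of_int (form_height r q) powr (- \<omega>)"
        using height \<omega> by (intro powr_mono2') auto
      moreover have "C / real N = (C * real N ^ d) powr (- \<omega>) * (C powr (1 + \<omega>) * real N powr (d * \<omega> - 1))"
        using C N by (simp add: powr_mult powr_realpow[symmetric] powr_powr powr_add powr_diff powr_minus field_simps)
      moreover have "(C * real N ^ d) powr (- \<omega>) * (C powr (1 + \<omega>) * real N powr (d * \<omega> - 1))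
          \<le> (C * real N ^ d) powr (- \<omega>) * 1"
        using elim(2) by (intro mult_left_mono) auto
      ultimately show ?thesis by linarith
    qed
    then have "\<bar>of_int (q i) * \<xi> j - of_int (q j) * \<xi> i\<bar> \<le> of_int (form_height r q) powr (- \<omega>)"
      if "i < j \<and> j \<le> r" for i j
      using small[of i j] that by simp
    then have "q \<in> ?S"
      using q(1) unfolding form_height_def by simp
    then have "q \<in> {q \<in> ?S. \<exists>i\<le>r. q i \<noteq> 0}"
      using q(2,3) by (intro CollectI conjI) blast+
    with elim(1) have "K / real N < E q"
      by (rule bspec)
    ultimately show False by linarith
  qed
  then show False by simp
qed

section \<open>The chain of inequalities\<close>

text \<open>For empty \<open>A\<close> the default value 0 has to be compared with the supremum of
  \<open>B\<close>, and this is where positivity of the elements enters.\<close>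

lemma sup0_mono:
  assumes "A \<subseteq> B" "\<And>x. x \<in> B \<Longrightarrow> x > 0"
  shows "sup0 A \<le> sup0 B"
proof (cases "A = {}")
  case True
  have "0 \<le> Sup (ereal ` B)" if "x \<in> B" for x
    using assms(2)[OF that] that by (intro SUP_upper2[of x]) auto
  with True show ?thesis
    by (auto simp: sup0_def)
next
  case False
  with assms(1) show ?thesis
    by (auto simp: sup0_def intro!: SUP_subset_mono)
qed

theorem theorem5:
  fixes r :: nat and \<xi> :: "nat \<Rightarrow> real" and s :: int
  assumes "r \<ge> 1"
    and "s = int (rat_dim (rat_span (\<xi> ` {..r}))) - 1"
    and "s > 0"
  shows "tau''' r \<xi> \<le> tau'' r \<xi> \<and> tau'' r \<xi> \<le> tau' r \<xi> \<and> tau' r \<xi> \<le> tau r \<xi>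
    \<and> tau r \<xi> \<le> 1 / omega0 r \<xi> \<and> 1 / omega0 r \<xi> \<le> ereal (of_int s)"
proof -
  define S where "S \<omega> = {q \<in> {..r} \<rightarrow>\<^sub>E (UNIV :: int set). \<forall>i j. i < j \<and> j \<le> r \<longrightarrow>
    \<bar>of_int (q i) * \<xi> j - of_int (q j) * \<xi> i\<bar> \<le> of_int (MAX k\<in>{..r}. \<bar>q k\<bar>) powr (- \<omega>)}" for \<omega>
  define d where "d = nat s"
  have d: "d > 0" "of_int s = real d" "rat_dim (rat_span (\<xi> ` {..r})) = Suc d"
    using assms by (auto simp: d_def)
  have omega0: "omega0 r \<xi> = Sup (ereal ` {\<omega>. \<omega> > 0 \<and> infinite (S \<omega>)})"
    by (simp add: omega0_def S_def)
  \<comment> \<open>Only exponents strictly below \<open>1 / d\<close> are known to be attained, so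
    the bound is reached through density of the order.\<close>
  have lower: "ereal (1 / real d) \<le> omega0 r \<xi>"
  proof (rule dense_le_bounded[of 0])
    show "0 < ereal (1 / real d)" using d by simp
    fix w assume w: "0 < w" "w < ereal (1 / real d)"
    then obtain \<omega> where \<omega>: "w = ereal \<omega>" by (cases w) auto
    have "infinite (S \<omega>)"
      unfolding S_def using infinite_approximations[OF d(3,1)] w \<omega> by simp
    then show "w \<le> omega0 r \<xi>"
      unfolding omega0 using w \<omega> by (intro Sup_upper) auto
  qed
  have omega0_pos: "0 < omega0 r \<xi>"
    using lower d(1) by (auto intro: less_le_trans[rotated])
  obtain k where k: "k \<le> r" "\<xi> k \<noteq> 0"
  proof (rule ccontr)
    assume "\<not> thesis"
    then have "\<And>k. k \<le> r \<Longrightarrow> \<xi> k = 0" using that by blast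
    then have "rat_dim (rat_span (\<xi> ` {..r})) \<le> 1"
      by (intro rat_dim_proportional_le_1[of 0 r "\<lambda>_. 1"]) auto
    with d show False by simp
  qed
  have upper: "ereal \<tau> \<le> 1 / omega0 r \<xi>" if \<tau>: "\<tau> \<in> T_set r \<xi>" for \<tau>
  proof -
    have pos: "\<tau> > 0" using \<tau> by (simp add: T_set_def)
    have "omega0 r \<xi> \<le> ereal (1 / \<tau>)"
      unfolding omega0
    proof (intro SUP_least)
      fix \<omega> assume "\<omega> \<in> {\<omega>. \<omega> > 0 \<and> infinite (S \<omega>)}"
      then have "\<tau> * \<omega> \<le> 1"
        using T_set_times_exponent_le_1[OF \<tau> k] unfolding S_def by blast
      then show "ereal \<omega> \<le> ereal (1 / \<tau>)"
        using pos by (simp add: field_simps)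
    qed
    with omega0_pos show ?thesis
      using pos by (cases "omega0 r \<xi>") (auto simp: field_simps one_ereal_def)
  qed
  \<comment> \<open>If \<open>T_set r \<xi>\<close> is empty, the left side is 0 and positivity of
    \<open>omega0 r \<xi>\<close> suffices. This also covers an infinite
    \<open>omega0 r \<xi>\<close>, for which \<open>upper\<close> leaves no element in the
    set.\<close>
  have "tau r \<xi> \<le> 1 / omega0 r \<xi>"
    unfolding tau_def sup0_def using upper omega0_pos by (auto intro: SUP_least)
  moreover have "1 / omega0 r \<xi> \<le> ereal (of_int s)"
    using lower omega0_pos d by (cases "omega0 r \<xi>") (auto simp: field_simps one_ereal_def)
  moreover have "tau''' r \<xi> \<le> tau'' r \<xi>"
    unfolding tau'''_def tau''_def by (intro sup0_mono T_set'''_subset_T_set'') (simp add: T_set''_def)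
  moreover have "tau'' r \<xi> \<le> tau' r \<xi>"
    unfolding tau''_def tau'_def by (intro sup0_mono T_set''_subset_T_set') (simp add: T_set'_def)
  moreover have "tau' r \<xi> \<le> tau r \<xi>"
    unfolding tau'_def tau_def by (intro sup0_mono T_set'_subset_T_set) (simp add: T_set_def)
  ultimately show ?thesis by blast
qed

end
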